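(* Let $K$ be a field of characteristic zero, let $a,b\in K$, and set $g_{a,b}(x)=\frac{1+ax}{1-bx^2}\in K[[x]]$. Let $\sum_{n\ge0}\mu_n z^n$ be the central transform of $g_{a,b}$, let $h_n=\det(\mu_{i+j})_{0\le i,j\le n}$ for $n\ge 0$, and let $H_{g_{a,b}}(x)=\sum_{n\ge0}h_nx^n\in K[[x]]$. Then $$H_{g_{a,b}}(x)=\frac{1-3bx+b^2(2+b)x^2-b^4x^3}{1-2(1+b)x+\bigl(a^2+4b-2a^2b+2b^2+a^2b^2\bigr)x^2-2b^2(1+b)x^3+b^4x^4}.$$ Equivalently, with $\sigma=a(1-b)$, $$h_0=1,\quad h_1=2-b,\quad h_2=4-2b-2b^2+b^3-\sigma^2,\quad h_3=8-4b-6b^2+2b^3+b^4-(b+4)\sigma^2,$$ and, for all $n\ge4$, $$h_n=2(1+b)h_{n-1}-\bigl(\sigma^2+4b+2b^2\bigr)h_{n-2}+2b^2(1+b)h_{n-3}-b^4h_{n-4}.$$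
   Context: All power series are formal. For a commutative $\mathbb{Q}$-algebra $R$ and $g(x)\in R[[x]]$ with $g(0)=1$, the central transform of $g$ is the power series $\mathcal{C}(g)(z)=\sum_{n\ge0}\mu_n z^n\in R[[z]]$ with coefficients $$\mu_n=[x^{2n}]\left(\frac{1}{(1-x)\,g\left(\frac{x}{1-x}\right)}\left(\frac{x}{1-x}\right)^n\right),$$ where $[x^{m}]F(x)$ denotes the coefficient of $x^m$ in $F(x)$. *)

theory Defs
  imports
    "HOL-Computational_Algebra.Formal_Power_Series"
    "Jordan_Normal_Form.Determinant"
begin

(* The central transform makes sense over any commutative Q-algebra; here the coefficient ring
   is a field of characteristic zero.  It is meant for g with g(0) = 1, so that the quotient
   is by a power series with constant coefficient 1, i.e. by a unit of K[[x]]. *)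
definition central_coeff :: "'a::field_char_0 fps \<Rightarrow> nat \<Rightarrow> 'a" where
  "central_coeff g n =
     fps_nth (1 / ((1 - fps_X) * fps_compose g (fps_X / (1 - fps_X)))
              * (fps_X / (1 - fps_X)) ^ n) (2 * n)"

definition central_transform :: "'a::field_char_0 fps \<Rightarrow> 'a fps" where
  "central_transform g = Abs_fps (central_coeff g)"

(* The indices i, j of the Hankel matrix run from 0 to n inclusive. *)
definition hankel_det :: "'a::comm_ring_1 fps \<Rightarrow> nat \<Rightarrow> 'a" where
  "hankel_det F n = det (mat (Suc n) (Suc n) (\<lambda>(i, j). fps_nth F (i + j)))"

definition hankel_series :: "'a::field_char_0 fps \<Rightarrow> 'a fps" where
  "hankel_series g = Abs_fps (hankel_det (central_transform g))"

definition g_ab :: "'a::field_char_0 \<Rightarrow> 'a \<Rightarrow> 'a fps" where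
  "g_ab a b = (1 + fps_const a * fps_X) / (1 - fps_const b * fps_X ^ 2)"

end

theory Submission
  imports Defs "HOL-Computational_Algebra.Formal_Laurent_Series"
begin

text \<open>
  Substituting \<open>t = x / (1 - x)\<close> turns the central transform into a sequence of moments: with
  \<open>u = (1 + t)\<^sup>2 / t = t + 2 + 1 / t\<close>, the coefficient \<open>\<mu>\<^sub>n\<close> is the constant term of the
  Laurent series \<open>u\<^sup>n / g(t)\<close> (\<open>central_coeff_constant_term\<close>). Hence \<open>h\<^sub>n\<close> is the Gram
  determinant of \<open>1, u, \<dots>, u\<^sup>n\<close> for the bilinear form sending \<open>x, y\<close> to the constant term of
  \<open>x y / g(t)\<close>, and the powers of \<open>u\<close> may be replaced by any monic polynomials of the same
  degrees in \<open>u\<close> (\<open>gram_det_unitriangular\<close>).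

  For \<open>g = g\<^sub>a\<^sub>b\<close> the powers of \<open>u\<close> are symmetric under \<open>t \<mapsto> 1 / t\<close>, so only the symmetric part of
  \<open>1 / g\<close> matters. Up to the factor 1/2 it is
  \<open>(2 + \<sigma> (t + 1 / t) - b (t\<^sup>2 + 1 / t\<^sup>2)) / ((1 + a t) (1 + a / t))\<close>, where \<open>\<sigma> = a (1 - b)\<close>.
  The basis \<open>q\<^sub>n = t\<^sup>n (1 + a / t) + t\<^sup>-\<^sup>n (1 + a t)\<close>, modified for \<open>n \<le> 1\<close>, is the one of Bernstein
  and Szego for this denominator: it clears \<open>(1 + a t) (1 + a / t)\<close> from the Gram matrix, and what
  remains are the coefficients of the numerator. So the Gram matrix is symmetric, pentadiagonal and, apart from
  its upper left 2 by 2 corner, Toeplitz with the entries \<open>2, \<sigma>, - b\<close> (\<open>szego_gram\<close>). This also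
  explains why \<open>a\<close> enters the answer through \<open>\<sigma>\<close> only.

  For such a matrix, Laplace expansion along the last rows gives linear recurrences for the
  leading minors and two auxiliary families. Eliminating these leaves a recurrence of order 5 for
  the leading minors, whose characteristic polynomial has a linear factor; the corner entries are such that
  this factor is not excited, and order 4 remains (\<open>lead_recurrence\<close>). The generating function is
  read off from the recurrence and the first four values.
\<close>

section \<open>Central coefficients as constant terms\<close>

no_notation vec_index (infixl "$" 100)

lemma fps_compose_times_nth:
  fixes h T F :: "'a::comm_ring_1 fps"
  assumes "T $ 0 = 0"
  shows "((h oo T) * F) $ N = (\<Sum>k\<le>N. h $ k * (T ^ k * F) $ N)"
proof -
  have "((h oo T) * F) $ N = (\<Sum>i\<le>N. (\<Sum>k\<le>N. h $ k * (T ^ k) $ i) * F $ (N - i))"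
    unfolding fps_mult_nth fps_compose_nth atLeast0AtMost
    by (intro sum.cong refl arg_cong2[of _ _ _ _ "(*)"] sum.mono_neutral_left)
      (auto simp: startsby_zero_power_prefix[OF assms])
  also have "\<dots> = (\<Sum>k\<le>N. \<Sum>i\<le>N. h $ k * (T ^ k) $ i * F $ (N - i))"
    unfolding sum_distrib_right by (rule sum.swap)
  also have "\<dots> = (\<Sum>k\<le>N. h $ k * (T ^ k * F) $ N)"
    by (simp add: fps_mult_nth atLeast0AtMost sum_distrib_left mult.assoc)
  finally show ?thesis .
qed

text \<open>
  With \<open>T = x / (1 - x)\<close>, the series here is \<open>x\<^bsup>n+k\<^esup> (1 - x)\<^bsup>-(n+k+1)\<^esup>\<close>, so the negative
  binomial series applies. Taking the coefficient of \<open>x\<^bsup>2n\<^esup>\<close> makes the upper index of the binomial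
  coefficient, \<open>(n + k) + (n - k)\<close>, independent of \<open>k\<close>.
\<close>

lemma central_kernel_nth:
  assumes "k \<le> n"
  shows "((fps_X / (1 - fps_X)) ^ k * ((fps_X / (1 - fps_X)) ^ n / (1 - fps_X))) $ (2 * n)
    = (of_nat (2 * n choose (n - k)) :: 'a::field_char_0)"
proof -
  have T: "fps_X / (1 - fps_X) = fps_X * inverse (1 - fps_X :: 'a fps)"
    by (simp add: fps_divide_unit)
  have "(fps_X / (1 - fps_X)) ^ k * ((fps_X / (1 - fps_X)) ^ n / (1 - fps_X))
      = fps_X ^ (n + k) * inverse ((1 - fps_const 1 * fps_X :: 'a fps) ^ (n + k + 1))"
    unfolding T by (simp add: fps_divide_unit power_mult_distrib power_add fps_inverse_mult
      fps_inverse_power mult_ac)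
  also have "\<dots> = fps_X ^ (n + k) * Abs_fps (\<lambda>j. of_nat ((n + k + j) choose j))"
    by (subst one_minus_const_fps_X_neg_power') simp_all
  also have "\<dots> $ (2 * n) = of_nat (2 * n choose (n - k))"
    using assms by (simp add: fps_X_power_mult_nth mult_2)
  finally show ?thesis .
qed

text \<open>
  By linearity in \<open>1 / g\<close>: each monomial \<open>t\<^sup>k\<close> of \<open>1 / g(t)\<close> contributes the coefficient computed in
  \<open>central_kernel_nth\<close>, and those with \<open>k > n\<close> contribute nothing because \<open>T\<^bsup>n+k\<^esup>\<close> starts in degree
  above \<open>2 n\<close>.
\<close>

lemma central_coeff_binomial:
  fixes g :: "'a::field_char_0 fps"
  assumes "g $ 0 \<noteq> 0"
  shows "central_coeff g n = (\<Sum>k\<le>n. inverse g $ k * of_nat (2 * n choose (n - k)))"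
proof -
  let ?T = "fps_X / (1 - fps_X) :: 'a fps"
  have T0: "?T $ 0 = 0" by (simp add: fps_divide_unit)
  have "1 / ((1 - fps_X) * (g oo ?T)) * ?T ^ n = (inverse g oo ?T) * (?T ^ n / (1 - fps_X))"
    using assms T0 by (simp add: fps_divide_unit fps_inverse_mult fps_inverse_compose mult_ac)
  then have "central_coeff g n
      = (\<Sum>k\<le>2 * n. inverse g $ k * (?T ^ k * (?T ^ n / (1 - fps_X))) $ (2 * n))"
    unfolding central_coeff_def by (simp only: fps_compose_times_nth[OF T0])
  also have "\<dots> = (\<Sum>k\<le>n. inverse g $ k * (?T ^ k * (?T ^ n / (1 - fps_X))) $ (2 * n))"
  proof (rule sum.mono_neutral_right)
    show "\<forall>k\<in>{..2 * n} - {..n}. inverse g $ k * (?T ^ k * (?T ^ n / (1 - fps_X))) $ (2 * n) = 0"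
    proof
      fix k assume "k \<in> {..2 * n} - {..n}"
      then have "2 * n < k + n" by auto
      moreover have "?T ^ k * (?T ^ n / (1 - fps_X)) = fps_X ^ (k + n) * inverse (1 - fps_X) ^ (k + n + 1)"
        by (simp add: fps_divide_unit power_mult_distrib power_add mult_ac)
      ultimately show "inverse g $ k * (?T ^ k * (?T ^ n / (1 - fps_X))) $ (2 * n) = 0"
        by (simp add: fps_X_power_mult_nth)
    qed
  qed auto
  also have "\<dots> = (\<Sum>k\<le>n. inverse g $ k * of_nat (2 * n choose (n - k)))"
    by (intro sum.cong refl) (simp only: central_kernel_nth atMost_iff)
  finally show ?thesis .
qed

text \<open>
  The function \<open>(1 + t)\<^sup>2 / t\<close>, written so that its symmetry under \<open>t \<mapsto> 1 / t\<close> is visible.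
\<close>

definition laurent_u :: "'a::field_char_0 fls" where
  "laurent_u = fls_X_intpow 1 + 2 + fls_X_intpow (-1)"

lemma laurent_u_power:
  "(laurent_u :: 'a::field_char_0 fls) ^ n = fls_X_intpow (- int n) * fps_to_fls ((1 + fps_X) ^ (2 * n))"
proof -
  have inv: "fls_X_intpow (-1) * fls_X_intpow 1 = (1 :: 'a fls)"
    by (subst fls_X_intpow_times_fls_X_intpow) simp
  have aux: "y * x = 1 \<Longrightarrow> x + 2 + y = y * (1 + x) ^ 2" for x y :: "'a fls"
  proof -
    have "y * (1 + x) ^ 2 = y + 2 * (y * x) + (y * x) * x"
      by (simp add: power2_eq_square algebra_simps)
    then show "y * x = 1 \<Longrightarrow> x + 2 + y = y * (1 + x) ^ 2" by simp
  qed
  have "fps_to_fls ((1 + fps_X) ^ 2) = (1 + fls_X_intpow 1 :: 'a fls) ^ 2"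
    by (simp add: fps_to_fls_power fls_X_conv_shift_1)
  then have "laurent_u = fls_X_intpow (-1) * fps_to_fls ((1 + fps_X :: 'a fps) ^ 2)"
    using aux[OF inv] by (simp add: laurent_u_def)
  then have "laurent_u ^ n
      = fls_X_intpow (-1) ^ n * fps_to_fls ((1 + fps_X :: 'a fps) ^ 2) ^ n"
    by (subst power_mult_distrib[symmetric]) (rule arg_cong)
  also have "\<dots> = fls_X_intpow (- int n) * fps_to_fls ((1 + fps_X) ^ (2 * n))"
    using fls_X_intpow_power[where 'a = 'a and i = "-1" and n = n]
    by (simp add: fps_to_fls_power power_mult)
  finally show ?thesis .
qed

text \<open>
  Both sides equal \<open>\<Sum>\<^sub>k c\<^sub>k (2n choose n - k)\<close>, where \<open>c\<^sub>k\<close> are the coefficients of \<open>1 / g\<close>: by the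
  binomial theorem, \<open>(2n choose n - k)\<close> is the coefficient of \<open>t\<^sup>-\<^sup>k\<close> in \<open>u\<^sup>n = (1 + t)\<^bsup>2n\<^esup> / t\<^sup>n\<close>.
\<close>

lemma central_coeff_constant_term:
  assumes "g $ 0 \<noteq> 0"
  shows "central_coeff g n = fls_nth (laurent_u ^ n * fps_to_fls (inverse g)) 0"
proof -
  have "laurent_u ^ n * fps_to_fls (inverse g)
     = fls_X_intpow (- int n) * fps_to_fls (inverse g * (1 + fps_X) ^ (2 * n))"
    by (simp add: laurent_u_power mult_ac fls_times_fps_to_fls)
  then have "fls_nth (laurent_u ^ n * fps_to_fls (inverse g)) 0 = (inverse g * (1 + fps_X) ^ (2 * n)) $ n"
    by (simp only: fls_X_intpow_times_conv_shift) simp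
  also have "\<dots> = (\<Sum>k\<le>n. inverse g $ k * of_nat (2 * n choose (n - k)))"
    by (simp add: fps_mult_nth atLeast0AtMost binomial_gbinomial flip: fps_binomial_of_nat)
  finally show ?thesis using central_coeff_binomial[OF assms] by simp
qed

section \<open>Gram determinants and change of basis\<close>

text \<open>
  The moment functional with weight \<open>w\<close>, on Laurent series.
\<close>

definition constant_term :: "'a::field_char_0 fps \<Rightarrow> 'a fls \<Rightarrow> 'a" where
  "constant_term w x = fls_nth (x * fps_to_fls w) 0"

lemma constant_term_add: "constant_term w (x + y) = constant_term w x + constant_term w y"
  and constant_term_scale: "constant_term w (fls_const c * x) = c * constant_term w x"
  and constant_term_0: "constant_term w 0 = 0"
  by (simp_all add: constant_term_def distrib_right mult.assoc)

lemma constant_term_sum: "constant_term w (\<Sum>i\<in>A. h i) = (\<Sum>i\<in>A. constant_term w (h i))"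
  by (induction A rule: infinite_finite_induct) (simp_all add: constant_term_0 constant_term_add)

text \<open>
  Membership in the span of \<open>q\<^sub>0, \<dots>, q\<^sub>n\<^sub>-\<^sub>1\<close> over the coefficient field. The coefficients are indexed
  by position because they become the rows of a transition matrix.
\<close>

definition lower_comb :: "(nat \<Rightarrow> 'a::field_char_0 fls) \<Rightarrow> nat \<Rightarrow> 'a fls \<Rightarrow> bool" where
  "lower_comb q n x \<longleftrightarrow> (\<exists>l. x = (\<Sum>k<n. fls_const (l k) * q k))"

lemma fls_const_add: "fls_const (x + y) = fls_const x + (fls_const y :: 'a::field_char_0 fls)"
  by (intro fls_eqI) simp

lemma lower_comb_0: "lower_comb q n 0"
  unfolding lower_comb_def by (intro exI[of _ "\<lambda>_. 0"]) simp

lemma lower_comb_add: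
  assumes "lower_comb q n x" "lower_comb q n y"
  shows "lower_comb q n (x + y)"
proof -
  obtain l l' where "x = (\<Sum>k<n. fls_const (l k) * q k)" "y = (\<Sum>k<n. fls_const (l' k) * q k)"
    using assms unfolding lower_comb_def by blast
  then have "x + y = (\<Sum>k<n. fls_const (l k + l' k) * q k)"
    by (simp add: fls_const_add distrib_right sum.distrib)
  then show ?thesis unfolding lower_comb_def by (rule exI[of _ "\<lambda>k. l k + l' k"])
qed

lemma lower_comb_scale:
  assumes "lower_comb q n x"
  shows "lower_comb q n (fls_const c * x)"
proof -
  obtain l where "x = (\<Sum>k<n. fls_const (l k) * q k)"
    using assms unfolding lower_comb_def by blast
  then have "fls_const c * x = (\<Sum>k<n. fls_const (c * l k) * q k)"
    by (simp add: sum_distrib_left fls_const_mult_const[symmetric] mult.assoc del: fls_const_mult_const)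
  then show ?thesis unfolding lower_comb_def by (rule exI[of _ "\<lambda>k. c * l k"])
qed

lemma lower_comb_basis:
  assumes "k < n"
  shows "lower_comb q n (q k)"
proof -
  have "(\<Sum>j<n. fls_const (if j = k then 1 else 0) * q j) = (\<Sum>j<n. if j = k then q j else 0)"
    by (intro sum.cong) auto
  also have "\<dots> = q k" using assms by simp
  finally show ?thesis unfolding lower_comb_def by (intro exI[of _ "\<lambda>j. if j = k then 1 else 0"]) simp
qed

lemma lower_comb_sum:
  assumes "\<And>k. k \<in> A \<Longrightarrow> lower_comb q n (h k)"
  shows "lower_comb q n (\<Sum>k\<in>A. h k)"
  using assms by (induction A rule: infinite_finite_induct) (auto intro: lower_comb_0 lower_comb_add)

text \<open>
  If multiplication by \<open>u\<close> sends \<open>q\<^sub>k\<close> to \<open>q\<^sub>k\<^sub>+\<^sub>1\<close> plus earlier terms, then \<open>q\<^sub>n\<close> behaves like a monic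
  polynomial of degree \<open>n\<close> in \<open>u\<close>. This form of monicity avoids writing the \<open>q\<^sub>n\<close> as polynomials.
\<close>

lemma lower_comb_power:
  assumes q0: "q 0 = 1"
    and step: "\<And>k. lower_comb q (Suc k) (u * q k - q (Suc k))"
  shows "lower_comb q n (u ^ n - q n)"
proof (induction n)
  case 0
  then show ?case by (simp add: q0 lower_comb_0)
next
  case (Suc n)
  have weaken: "lower_comb q m x \<Longrightarrow> m \<le> m' \<Longrightarrow> lower_comb q m' x" for m m' x
    by (auto simp: lower_comb_def intro!: lower_comb_sum[unfolded lower_comb_def]
      lower_comb_scale[unfolded lower_comb_def] lower_comb_basis[unfolded lower_comb_def])
  obtain l where l: "u ^ n - q n = (\<Sum>k<n. fls_const (l k) * q k)"
    using Suc unfolding lower_comb_def by blast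
  have "u ^ Suc n - q (Suc n) = (u * q n - q (Suc n)) + u * (u ^ n - q n)"
    by (simp add: algebra_simps)
  also have "u * (u ^ n - q n) = (\<Sum>k<n. fls_const (l k) * ((u * q k - q (Suc k)) + q (Suc k)))"
    unfolding l by (simp add: sum_distrib_left mult_ac)
  also have "lower_comb q (Suc n) ((u * q n - q (Suc n)) + \<dots>)"
  proof (intro lower_comb_add lower_comb_sum lower_comb_scale lower_comb_basis step)
    show "lower_comb q (Suc n) (u * q k - q (Suc k))" if "k \<in> {..<n}" for k
      using that by (intro weaken[OF step]) auto
  qed auto
  finally show ?case .
qed

text \<open>
  The two Gram matrices are congruent, \<open>L G L\<^sup>T\<close> and \<open>G\<close>, with \<open>L\<close> lower triangular with unit diagonal.
\<close>

lemma gram_det_unitriangular: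
  assumes "\<And>i. lower_comb q i (v i - q i)"
  shows "det (mat n n (\<lambda>(i, j). constant_term w (v i * v j))) = det (mat n n (\<lambda>(i, j). constant_term w (q i * q j)))"
proof -
  obtain l where l: "v i - q i = (\<Sum>k<i. fls_const (l i k) * q k)" for i
    using assms unfolding lower_comb_def by metis
  define L where "L i k = (if k < i then l i k else if k = i then 1 else 0)" for i k
  have v: "v i = (\<Sum>k<n. fls_const (L i k) * q k)" if "i < n" for i
  proof -
    have "(\<Sum>k<n. fls_const (L i k) * q k) = (\<Sum>k<Suc i. fls_const (L i k) * q k)"
      using that by (intro sum.mono_neutral_right) (auto simp: L_def)
    also have "\<dots> = (v i - q i) + q i"
      by (simp add: L_def l)
    finally show ?thesis by simp
  qed
  let ?L = "mat n n (\<lambda>(i, k). L i k)" and ?G = "mat n n (\<lambda>(i, j). constant_term w (q i * q j))"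
  have "mat n n (\<lambda>(i, j). constant_term w (v i * v j)) = ?L * ?G * transpose_mat ?L"
  proof (rule eq_matI)
    fix i j assume "i < dim_row (?L * ?G * transpose_mat ?L)" "j < dim_col (?L * ?G * transpose_mat ?L)"
    then have ij: "i < n" "j < n" by auto
    have "constant_term w (v i * v j) = (\<Sum>m<n. \<Sum>k<n. L i k * constant_term w (q k * q m) * L j m)"
    proof -
      have "v i * v j = (\<Sum>k<n. \<Sum>m<n. fls_const (L i k * L j m) * (q k * q m))"
        using ij by (simp add: v sum_product mult_ac fls_const_mult_const[symmetric] del: fls_const_mult_const)
      then have "constant_term w (v i * v j) = (\<Sum>k<n. \<Sum>m<n. L i k * constant_term w (q k * q m) * L j m)"
        by (simp only: constant_term_sum constant_term_scale) (simp add: mult_ac)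
      then show ?thesis by (subst sum.swap)
    qed
    then show "mat n n (\<lambda>(i, j). constant_term w (v i * v j)) $$ (i, j) = (?L * ?G * transpose_mat ?L) $$ (i, j)"
      using ij by (simp add: scalar_prod_def sum_distrib_right atLeast0LessThan)
  qed auto
  moreover have "det ?L = 1"
    by (subst det_lower_triangular[of n]) (auto simp: L_def prod_list_diag_prod)
  moreover have "det (?L * ?G * transpose_mat ?L) = det ?L * det ?G * det ?L"
    by (subst det_mult[of _ n], (auto intro: mult_carrier_mat)[2], subst det_mult[of _ n])
      (auto simp: det_transpose[of _ n])
  ultimately show ?thesis by simp
qed

section \<open>The Bernstein-Szego basis\<close>

text \<open>
  For \<open>k \<ge> 1\<close>, \<open>t\<^sup>k + t\<^sup>-\<^sup>k\<close> is a Chebyshev polynomial of the first kind in \<open>t + 1 / t\<close>, up to scaling.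
  Integer indices make the product formula free of case distinctions.
\<close>

definition sympow :: "int \<Rightarrow> 'a::field_char_0 fls" where
  "sympow k = fls_X_intpow k + fls_X_intpow (- k)"

lemma sympow_0: "sympow 0 = 2"
  by (simp add: sympow_def)

lemma sympow_uminus: "sympow (- k) = sympow k"
  by (simp add: sympow_def add.commute)

lemma sympow_mult: "sympow k * sympow l = sympow (k + l) + sympow (k - l)"
  unfolding sympow_def distrib_left distrib_right fls_X_intpow_times_fls_X_intpow
  by (simp add: add_ac)

text \<open>
  For \<open>n \<ge> 2\<close> this is \<open>t\<^sup>n (1 + a / t) + t\<^sup>-\<^sup>n (1 + a t)\<close>. The same formula for \<open>n = 1\<close> would give the
  constant \<open>2 a\<close> in place of \<open>a\<close>; it is changed to make \<open>q\<^sub>1\<close> orthogonal to \<open>q\<^sub>0 = 1\<close>, after which all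
  entries of the Gram matrix depend on \<open>a\<close> only through \<open>a (1 - b)\<close>.
\<close>

definition szego :: "'a::field_char_0 \<Rightarrow> nat \<Rightarrow> 'a fls" where
  "szego a n = (if n = 0 then 1 else if n = 1 then sympow 1 + fls_const a
     else sympow (int n) + fls_const a * sympow (int n - 1))"

lemma laurent_u_sympow: "laurent_u = sympow 1 + 2"
  by (simp add: laurent_u_def sympow_def)

lemma sympow_1_mult: "sympow 1 * sympow k = sympow (k + 1) + sympow (k - 1)"
  using sympow_mult[of k 1] by (simp add: mult.commute)

text \<open>
  Away from the start, \<open>(t + 1 / t) q\<^sub>k = q\<^sub>k\<^sub>+\<^sub>1 + q\<^sub>k\<^sub>-\<^sub>1\<close>, as for Chebyshev polynomials. The cases
  \<open>k \<le> 2\<close> absorb the irregular \<open>q\<^sub>0\<close> and \<open>q\<^sub>1\<close>.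
\<close>

lemma szego_step: "lower_comb (szego a) (Suc k) (laurent_u * szego a k - szego a (Suc k))"
proof -
  have two: "laurent_u * x = sympow 1 * x + x + x" for x :: "'a fls"
    by (simp add: laurent_u_sympow algebra_simps)
  note intros = lower_comb_add lower_comb_scale lower_comb_basis
  consider "k = 0" | "k = 1" | "k = 2" | "k \<ge> 3" by linarith
  then show ?thesis
  proof cases
    case 1
    then have eq: "laurent_u * szego a k - szego a (Suc k) 
        = szego a 0 + szego a 0 + fls_const (- a) * szego a 0"
      by (simp add: laurent_u_sympow szego_def)
    show ?thesis unfolding eq by (intro intros) (use 1 in auto)
  next
    case 2
    then have eq: "laurent_u * szego a k - szego a (Suc k) 
        = szego a 0 + szego a 0 + szego a 1 + szego a 1"
      by (simp add: two szego_def sympow_1_mult sympow_0 distrib_left)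
    show ?thesis unfolding eq by (intro intros) (use 2 in auto)
  next
    case 3
    then have eq: "laurent_u * szego a k - szego a (Suc k) 
        = szego a 1 + fls_const a * szego a 0 + szego a 2 + szego a 2"
      by (simp add: two szego_def sympow_1_mult sympow_0 distrib_left mult.left_commute[of "sympow 1"])
    show ?thesis unfolding eq by (intro intros) (use 3 in auto)
  next
    case 4
    then have "k - Suc 0 \<noteq> Suc 0" by simp
    with 4 have eq: "laurent_u * szego a k - szego a (Suc k) 
        = szego a (k - 1) + szego a k + szego a k"
      by (simp add: two szego_def sympow_1_mult distrib_left mult.left_commute[of "sympow 1"] of_nat_diff algebra_simps)
    show ?thesis unfolding eq by (intro intros) (use 4 in auto)
  qed
qed

section \<open>The Gram matrix\<close>

definition weight :: "'a::field_char_0 \<Rightarrow> 'a \<Rightarrow> 'a fps" where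
  "weight a b = inverse (g_ab a b)"

text \<open>
  The coefficients of \<open>(1 - b t\<^sup>2) / (1 + a t)\<close> are geometric from degree 2 on, by comparing
  coefficients in \<open>weight a b * (1 + a t) = 1 - b t\<^sup>2\<close>.
\<close>

lemma weight_nth:
  shows "fps_nth (weight a b) 0 = 1"
    and "fps_nth (weight a b) 1 = - a"
    and "fps_nth (weight a b) 2 = a ^ 2 - b"
    and "n \<ge> 2 \<Longrightarrow> fps_nth (weight a b) (Suc n) = - a * fps_nth (weight a b) n"
proof -
  let ?n = "1 + fps_const a * fps_X" and ?d = "1 - fps_const b * fps_X ^ 2"
  have d0: "fps_nth ?d 0 \<noteq> 0" and n0: "fps_nth ?n 0 \<noteq> 0" by (simp_all add: power2_eq_square)
  have "weight a b * ?n = inverse (?n * inverse ?d) * ?n"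
    using d0 by (simp add: weight_def g_ab_def fps_divide_unit)
  also have "\<dots> = ?d * (inverse ?n * ?n)"
    using d0 by (simp add: fps_inverse_mult)
  also have "\<dots> = ?d"
    using n0 by (simp add: inverse_mult_eq_1)
  finally have "weight a b = ?d - fps_const a * (fps_X * weight a b)"
    by (simp add: algebra_simps)
  then have rec: "fps_nth (weight a b) m = fps_nth ?d m - a * fps_nth (fps_X * weight a b) m" for m
    by (metis fps_mult_left_const_nth fps_sub_nth)
  show w0: "fps_nth (weight a b) 0 = 1"
    using rec[of 0] by (simp add: power2_eq_square)
  show w1: "fps_nth (weight a b) 1 = - a"
    using rec[of 1] w0 by (simp add: fps_X_power_iff)
  show "fps_nth (weight a b) 2 = a ^ 2 - b"
    using rec[of 2] w1 by (simp add: fps_X_power_iff power2_eq_square)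
  show "n \<ge> 2 \<Longrightarrow> fps_nth (weight a b) (Suc n) = - a * fps_nth (weight a b) n"
    using rec[of "Suc n"] by (simp add: fps_X_power_iff)
qed

lemma constant_term_sympow: "n \<ge> 1 \<Longrightarrow> constant_term w (sympow (int n)) = fps_nth w n"
  unfolding constant_term_def sympow_def distrib_right fls_X_intpow_times_conv_shift by simp

text \<open>
  For \<open>k \<ge> 1\<close> only \<open>t\<^sup>-\<^sup>k\<close> contributes to the constant term, and picks the coefficient of \<open>t\<^sup>k\<close> in the
  weight; for \<open>k = 0\<close> both halves of \<open>t\<^sup>k + t\<^sup>-\<^sup>k\<close> contribute, hence the value 2.
\<close>

lemma moments:
  fixes a b :: "'a::field_char_0"
  defines "M \<equiv> \<lambda>k. constant_term (weight a b) (sympow k)"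
  shows "M (- k) = M k" and "M 0 = 2" and "M 1 = - a" and "M 2 = a ^ 2 - b"
    and "k \<ge> 2 \<Longrightarrow> M (k + 1) = - a * M k"
proof -
  show "M (- k) = M k" by (simp add: M_def sympow_uminus)
  have "M 0 = constant_term (weight a b) (1 + 1)" by (simp add: M_def sympow_0)
  also have "\<dots> = 2" unfolding constant_term_add by (simp add: constant_term_def weight_nth)
  finally show "M 0 = 2" .
  show "M 1 = - a" using constant_term_sympow[of 1 "weight a b"] by (simp add: M_def weight_nth(2)[simplified])
  show "M 2 = a ^ 2 - b" using constant_term_sympow[of 2 "weight a b"] by (simp add: M_def weight_nth)
  assume k: "k \<ge> 2"
  then show "M (k + 1) = - a * M k"
    using constant_term_sympow[of "nat k" "weight a b"] constant_term_sympow[of "Suc (nat k)" "weight a b"]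
      weight_nth(4)[of "nat k" a b] by (simp add: M_def add.commute)
qed

text \<open>
  For \<open>i, j \<ge> 2\<close>, in the product \<open>q\<^sub>i q\<^sub>j\<close> the moments of index near \<open>i + j\<close> occur in the combination
  \<open>M\<^sub>n + 2 a M\<^sub>n\<^sub>-\<^sub>1 + a\<^sup>2 M\<^sub>n\<^sub>-\<^sub>2\<close> with \<open>n = i + j\<close>, which vanishes because the moments are geometric
  with ratio \<open>- a\<close> from index 2 on. What is left depends on \<open>i - j\<close> only and vanishes for the
  same reason once \<open>i - j \<ge> 3\<close>.
\<close>

lemma szego_gram:
  fixes a b :: "'a::field_char_0"
  defines "G \<equiv> \<lambda>i j. constant_term (weight a b) (szego a i * szego a j)"
  shows "G 0 0 = 1" and "G 1 0 = 0" and "G 1 1 = 2 - b"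
    and "i \<ge> 2 \<Longrightarrow> G i i = 2"
    and "i \<ge> 1 \<Longrightarrow> G (Suc i) i = a * (1 - b)"
    and "G (Suc (Suc i)) i = - b"
    and "j + 2 < i \<Longrightarrow> G i j = 0"
proof -
  define M where "M k = constant_term (weight a b) (sympow k)" for k
  note M = moments[where a = a and b = b, folded M_def]
  have constants: "constant_term (weight a b) 1 = 1" "constant_term (weight a b) (fls_const c) = c" for c
    by (simp_all add: constant_term_def weight_nth)
  note ct_simps = constant_term_add constant_term_scale constants M_def[symmetric]
  have M3: "M 3 = - a * M 2" using M(5)[of 2] by simp
  show "G 0 0 = 1" by (simp add: G_def szego_def ct_simps)
  show "G 1 0 = 0" by (simp add: G_def szego_def ct_simps M)
  have eq: "szego a 1 * szego a 1 = sympow 2 + sympow 0 + fls_const a * sympow 1 + fls_const a * sympow 1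
      + fls_const (a * a)"
    by (simp add: szego_def distrib_left distrib_right sympow_1_mult)
  show "G 1 1 = 2 - b"
    unfolding G_def eq ct_simps by (simp add: M power2_eq_square)
  have col0: "G i 0 = M (int i) + a * M (int i - 1)" if "i \<ge> 2" for i
    using that by (simp add: G_def szego_def ct_simps)
  \<comment> \<open>The Toeplitz part: the moments with index near \<open>i + j\<close> have cancelled.\<close>
  have main: "G i j = (1 + a ^ 2) * M (int i - int j) + a * (M (int i - int j + 1) + M (int i - int j - 1))"
    if "i \<ge> 2" "j \<ge> 1" for i j
  proof (cases "j = 1")
    case True
    have "szego a i * szego a 1 = sympow (int i) * sympow 1 + fls_const a * sympow (int i)
       + fls_const a * (sympow (int i - 1) * sympow 1) + fls_const a * (fls_const a * sympow (int i - 1))"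
      using \<open>i \<ge> 2\<close> by (simp add: szego_def algebra_simps)
    then have "G i 1 = M (int i + 1) + M (int i - 1) + a * M (int i)
       + a * (M (int i) + M (int i - 2)) + a * (a * M (int i - 1))"
      by (simp add: G_def ct_simps sympow_mult)
    also have "\<dots> = (1 + a ^ 2) * M (int i - 1) + a * (M (int i) + M (int i - 2))
       + (M (int i + 1) + a * M (int i))"
      by (simp only: power2_eq_square ring_distribs mult_1_left mult.assoc add_ac)
    also have "M (int i + 1) + a * M (int i) = 0"
      using M(5)[of "int i"] \<open>i \<ge> 2\<close> by simp
    finally show ?thesis
      using True by simp
  next
    case False
    let ?i = "int i" and ?j = "int j"
    have eq: "szego a i * szego a j = sympow ?i * sympow ?j + fls_const a * (sympow ?i * sympow (?j - 1))
       + fls_const a * (sympow (?i - 1) * sympow ?j) 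
       + fls_const a * (fls_const a * (sympow (?i - 1) * sympow (?j - 1)))"
      using that False by (simp add: szego_def algebra_simps)
    \<comment> \<open>Normal forms for the indices that the product formula produces.\<close>
    have indices: "?i + (?j - 1) = ?i + ?j - 1" "?i - (?j - 1) = ?i - ?j + 1"
      "?i - 1 + ?j = ?i + ?j - 1" "?i - 1 - ?j = ?i - ?j - 1"
      "?i - 1 + (?j - 1) = ?i + ?j - 2" "?i - 1 - (?j - 1) = ?i - ?j"
      by simp_all
    have "G i j = M (?i + ?j) + M (?i - ?j) + a * (M (?i + ?j - 1) + M (?i - ?j + 1))
       + a * (M (?i + ?j - 1) + M (?i - ?j - 1)) + a * (a * (M (?i + ?j - 2) + M (?i - ?j)))"
      unfolding G_def eq sympow_mult indices ct_simps by (rule refl)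
    also have "\<dots> = (1 + a ^ 2) * M (?i - ?j) + a * (M (?i - ?j + 1) + M (?i - ?j - 1))
       + (M (?i + ?j) + a * M (?i + ?j - 1)) + a * (M (?i + ?j - 1) + a * M (?i + ?j - 2))"
      by (simp only: power2_eq_square ring_distribs mult_1_left mult.assoc add_ac)
    also have "M (?i + ?j) + a * M (?i + ?j - 1) = 0"
      using M(5)[of "?i + ?j - 1"] that False by simp
    also have "M (?i + ?j - 1) + a * M (?i + ?j - 2) = 0"
      using M(5)[of "?i + ?j - 2"] that False by simp
    finally show ?thesis by simp
  qed
  show "G i i = 2" if "i \<ge> 2"
  proof -
    have "G i i = (1 + a ^ 2) * M 0 + a * (M 1 + M (- 1))"
      using that main[of i i] by simp
    then show ?thesis
      unfolding M(1-3) by (simp add: power2_eq_square algebra_simps)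
  qed
  show "G (Suc i) i = a * (1 - b)" if "i \<ge> 1"
  proof -
    have "G (Suc i) i = (1 + a ^ 2) * M 1 + a * (M 2 + M 0)"
      using that main[of "Suc i" i] by simp
    then show ?thesis
      unfolding M(2-4) by (simp add: power2_eq_square algebra_simps)
  qed
  show "G (Suc (Suc i)) i = - b"
  proof (cases "i = 0")
    case True
    then have "G (Suc (Suc i)) i = M 2 + a * M 1" using col0[of 2] by (simp add: numeral_2_eq_2)
    then show ?thesis unfolding M(3,4) by (simp add: power2_eq_square algebra_simps)
  next
    case False
    then have "G (Suc (Suc i)) i = (1 + a ^ 2) * M 2 + a * (M 3 + M 1)"
      using main[of "Suc (Suc i)" i] by simp
    then show ?thesis unfolding M3 M(3,4) by (simp add: power2_eq_square algebra_simps)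
  qed
  show "G i j = 0" if "j + 2 < i"
  proof (cases "j = 0")
    case True
    then show ?thesis using that col0[of i] M(5)[of "int i - 1"] by simp
  next
    case False
    let ?r = "int i - int j"
    have "G i j = (1 + a ^ 2) * M ?r + a * (M (?r + 1) + M (?r - 1))"
      using main[of i j] that False by simp
    also have "\<dots> = (M ?r + a * M (?r - 1)) + a * (M (?r + 1) + a * M ?r)"
      by (simp only: power2_eq_square ring_distribs mult_1_left mult.assoc add_ac)
    also have "M (?r + 1) + a * M ?r = 0"
      using M(5)[of ?r] that by simp
    also have "M ?r + a * M (?r - 1) = 0"
      using M(5)[of "?r - 1"] that by simp
    finally show ?thesis by simp
  qed
qed

section \<open>Leading minors of a pentadiagonal Toeplitz matrix\<close>

lemma det_mat_cong:
  assumes "\<And>i j. i < n \<Longrightarrow> j < n \<Longrightarrow> g i j = h i j"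
  shows "det (mat n n (\<lambda>(i, j). g i j)) = det (mat n n (\<lambda>(i, j). h i j))"
  by (rule arg_cong[of _ _ det]) (use assms in \<open>auto intro!: eq_matI\<close>)

lemma det_mat_swap: "det (mat n n (\<lambda>(i, j). g j i)) = det (mat n n (\<lambda>(i, j). g i j))"
  for g :: "nat \<Rightarrow> nat \<Rightarrow> 'a::comm_ring_1"
proof -
  have "mat n n (\<lambda>(i, j). g j i) = transpose_mat (mat n n (\<lambda>(i, j). g i j))"
    by (intro eq_matI) auto
  then show ?thesis by (simp add: det_transpose[of _ n])
qed

text \<open>
  Laplace expansion along the last row, with the minors again given by entry functions so that it
  can be iterated. Deleting column \<open>j\<close> is precomposition with \<open>insert_index j\<close>.
\<close>

lemma det_last_row:
  fixes g :: "nat \<Rightarrow> nat \<Rightarrow> 'a::comm_ring_1"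
  shows "det (mat (Suc n) (Suc n) (\<lambda>(i, j). g i j)) =
    (\<Sum>j<Suc n. g n j * ((-1) ^ (n + j) * det (mat n n (\<lambda>(i, k). g i (insert_index j k)))))"
proof -
  have "mat_delete (mat (Suc n) (Suc n) (\<lambda>(i, j). g i j)) n j
      = mat n n (\<lambda>(i, k). g i (insert_index j k))" if "j < Suc n" for j
    using that by (intro eq_matI) (auto simp: mat_delete_def insert_index_def)
  then show ?thesis
    by (subst laplace_expansion_row[of _ "Suc n" n]) (auto simp: cofactor_def intro!: sum.cong)
qed

lemma insert_index_last: "det (mat n n (\<lambda>(i, k). g i (insert_index n k))) = det (mat n n (\<lambda>(i, k). g i k))"
  by (rule det_mat_cong) simp

lemma det_last_row_one:
  fixes g :: "nat \<Rightarrow> nat \<Rightarrow> 'a::comm_ring_1"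
  assumes "\<And>j. j < n \<Longrightarrow> g n j = 0"
  shows "det (mat (Suc n) (Suc n) (\<lambda>(i, j). g i j)) = g n n * det (mat n n (\<lambda>(i, j). g i j))"
  using assms by (simp add: det_last_row insert_index_last)

lemma det_last_row_two:
  fixes g :: "nat \<Rightarrow> nat \<Rightarrow> 'a::comm_ring_1"
  assumes "\<And>j. j < n \<Longrightarrow> g (Suc n) j = 0"
  shows "det (mat (Suc (Suc n)) (Suc (Suc n)) (\<lambda>(i, j). g i j)) =
      g (Suc n) (Suc n) * det (mat (Suc n) (Suc n) (\<lambda>(i, j). g i j))
      - g (Suc n) n * det (mat (Suc n) (Suc n) (\<lambda>(i, j). g i (insert_index n j)))"
  using assms unfolding det_last_row[of "Suc n"]
  by (subst sum.lessThan_Suc, subst sum.lessThan_Suc) (simp add: insert_index_last)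

lemma det_last_row_three:
  fixes g :: "nat \<Rightarrow> nat \<Rightarrow> 'a::comm_ring_1"
  assumes "\<And>j. j < n \<Longrightarrow> g (Suc (Suc n)) j = 0"
  shows "det (mat (Suc (Suc (Suc n))) (Suc (Suc (Suc n))) (\<lambda>(i, j). g i j)) =
      g (Suc (Suc n)) (Suc (Suc n)) * det (mat (Suc (Suc n)) (Suc (Suc n)) (\<lambda>(i, j). g i j))
      - g (Suc (Suc n)) (Suc n) *
        det (mat (Suc (Suc n)) (Suc (Suc n)) (\<lambda>(i, j). g i (insert_index (Suc n) j)))
      + g (Suc (Suc n)) n *
        det (mat (Suc (Suc n)) (Suc (Suc n)) (\<lambda>(i, j). g i (insert_index n j)))"
  using assms unfolding det_last_row[of "Suc (Suc n)"]
  by (subst sum.lessThan_Suc, subst sum.lessThan_Suc, subst sum.lessThan_Suc)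
    (simp add: insert_index_last)

text \<open>
  The bounds on \<open>i\<close> in \<open>diag\<close> and \<open>off\<close> leave the entries at \<open>(0,0)\<close>, \<open>(0,1)\<close>, \<open>(1,0)\<close> and \<open>(1,1)\<close> free.
  The expansions below proceed from the last row, where the matrix is Toeplitz.
\<close>

locale pentadiagonal =
  fixes B :: "nat \<Rightarrow> nat \<Rightarrow> 'a::comm_ring_1" and d e f :: 'a
  assumes sym: "B i j = B j i"
    and band: "j + 2 < i \<Longrightarrow> B i j = 0"
    and diag: "2 \<le> i \<Longrightarrow> B i i = d"
    and off: "1 \<le> i \<Longrightarrow> B (Suc i) i = e"
    and far: "B (Suc (Suc i)) i = f"
begin

text \<open>
  Expanding a leading minor along its last rows produces minors in which the last index \<open>n\<close> is
  replaced by \<open>n + 1\<close> in the rows only (\<open>side\<close>) or in rows and columns (\<open>gap\<close>). Since the band has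
  width 2, these three families are closed under expansion.
\<close>

definition lead :: "nat \<Rightarrow> 'a" where
  "lead n = det (mat n n (\<lambda>(i, j). B i j))"

definition side :: "nat \<Rightarrow> 'a" where
  "side n = det (mat (Suc n) (Suc n) (\<lambda>(i, j). B (insert_index n i) j))"

definition gap :: "nat \<Rightarrow> 'a" where
  "gap n = det (mat (Suc n) (Suc n) (\<lambda>(i, j). B (insert_index n i) (insert_index n j)))"

lemma side_transposed: "det (mat (Suc n) (Suc n) (\<lambda>(i, j). B i (insert_index n j))) = side n"
  unfolding side_def by (subst sym, subst det_mat_swap) simp

lemma side_Suc: "side (Suc n) = e * lead (Suc n) - f * side n"
proof -
  have "side (Suc n) = B (Suc (Suc n)) (Suc n) * lead (Suc n) - B (Suc (Suc n)) n * side n"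
    unfolding side_def[of "Suc n"] lead_def side_transposed[of n, symmetric]
    by (subst det_last_row_two)
      (auto simp: band insert_index_def intro!: arg_cong2[of _ _ _ _ "(-)"]
        arg_cong2[of _ _ _ _ "(*)"] det_mat_cong)
  then show ?thesis using off[of "Suc n"] far[of n] by simp
qed

lemma gap_Suc: "gap (Suc n) = d * lead (Suc n) - f ^ 2 * lead n"
proof -
  let ?M = "det (mat (Suc n) (Suc n) (\<lambda>(i, j). B i (insert_index (Suc n) (insert_index n j))))"
  have "?M = det (mat (Suc n) (Suc n) (\<lambda>(i, j). B (insert_index (Suc n) (insert_index n i)) j))"
    by (subst sym, subst det_mat_swap) simp
  also have "\<dots> = B (Suc (Suc n)) n * lead n"
    unfolding lead_def
    by (subst det_last_row_one)
      (auto simp: band insert_index_def intro!: arg_cong2[of _ _ _ _ "(*)"] det_mat_cong)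
  finally have M: "?M = f * lead n"
    using far[of n] by simp
  have "gap (Suc n) = B (Suc (Suc n)) (Suc (Suc n)) * lead (Suc n) - B (Suc (Suc n)) n * ?M"
    unfolding gap_def lead_def
    by (subst det_last_row_two)
      (auto simp: band insert_index_def intro!: arg_cong2[of _ _ _ _ "(-)"]
        arg_cong2[of _ _ _ _ "(*)"] det_mat_cong)
  then show ?thesis
    using diag[of "Suc (Suc n)"] far[of n] M by (simp add: power2_eq_square mult_ac)
qed

text \<open>
  Of the three minors in the last row's expansion, the one without column \<open>n\<close> has only two entries
  left in its last column and is expanded along that column in turn.
\<close>

lemma lead_expand: "lead (n + 3) = d * lead (n + 2) - e * side (Suc n) + f * (e * side n - f * gap n)"
proof -
  let ?M = "det (mat (Suc (Suc n)) (Suc (Suc n)) (\<lambda>(i, j). B i (insert_index n j)))"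
  have "?M = det (mat (Suc (Suc n)) (Suc (Suc n)) (\<lambda>(i, j). B (insert_index n i) j))"
    by (subst sym, subst det_mat_swap) simp
  also have "\<dots> = B (Suc (Suc n)) (Suc n) * side n - B (Suc (Suc n)) n * gap n"
    unfolding side_def gap_def
    by (subst det_last_row_two)
      (auto simp: band insert_index_def intro!: arg_cong2[of _ _ _ _ "(-)"]
        arg_cong2[of _ _ _ _ "(*)"] det_mat_cong)
  finally have M: "?M = e * side n - f * gap n"
    using off[of "Suc n"] far[of n] by simp
  have "lead (n + 3) = B (Suc (Suc n)) (Suc (Suc n)) * lead (n + 2)
      - B (Suc (Suc n)) (Suc n) * side (Suc n) + B (Suc (Suc n)) n * ?M"
    unfolding lead_def side_transposed[symmetric] add_2_eq_Suc' add_Suc_right numeral_3_eq_3 add_0_right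
    by (rule det_last_row_three) (simp add: band)
  then show ?thesis
    using M off[of "Suc n"] far[of n] diag[of "Suc (Suc n)"] by simp
qed

text \<open>
  Write \<open>S\<close> for the shift \<open>n \<mapsto> n - 1\<close>. After \<open>gap\<close> is eliminated, the expansion of \<open>lead\<close> reads
  \<open>(1 - d S + d f\<^sup>2 S\<^sup>3 - f\<^sup>4 S\<^sup>4) lead + e S (1 - f S) side = 0\<close>, up to the indexing of \<open>side\<close>. The
  polynomial applied to \<open>lead\<close> equals \<open>(1 - f S) (1 + f S) (1 - d S + f\<^sup>2 S\<^sup>2)\<close>, so that \<open>1 - f S\<close> is a
  common factor: the quantity left after removing it, called \<open>J\<close> below, is multiplied by \<open>f\<close> at every
  step. The hypothesis says that \<open>J\<close> vanishes at the start; hence it vanishes throughout. Applying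
  \<open>1 + f S\<close> to it removes \<open>side\<close> because \<open>(1 + f S) side\<close> is a multiple of \<open>lead\<close>, by \<open>side_Suc\<close>.
\<close>

lemma lead_recurrence:
  assumes "lead 3 + (f - d) * lead 2 + (f ^ 2 - d * f) * lead 1 + f ^ 3 * lead 0 + e * side 1 = 0"
  shows "lead (n + 4) = (d - 2 * f) * lead (n + 3) + (2 * d * f - 2 * f ^ 2 - e ^ 2) * lead (n + 2)
    + (d * f ^ 2 - 2 * f ^ 3) * lead (n + 1) - f ^ 4 * lead n"
proof -
  define J where "J n = lead (n + 3) + (f - d) * lead (n + 2) + (f ^ 2 - d * f) * lead (n + 1)
      + f ^ 3 * lead n + e * side (n + 1)" for n
  have J_Suc: "J (Suc n) = f * J n" for n
  proof -
    have "lead (n + 4) = d * lead (n + 3) - e * side (n + 2) 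
      + f * (e * side (n + 1) - f * (d * lead (n + 1) - f ^ 2 * lead n))"
      using lead_expand[of "Suc n"] gap_Suc[of n] by (simp add: numeral_eq_Suc)
    then show ?thesis by (simp add: J_def numeral_eq_Suc algebra_simps)
  qed
  have J0: "J n = 0" for n
    using assms by (induction n) (simp_all add: J_Suc, simp add: J_def numeral_eq_Suc)
  have "J (Suc n) + f * J n - (lead (n + 4) - ((d - 2 * f) * lead (n + 3)
    + (2 * d * f - 2 * f ^ 2 - e ^ 2) * lead (n + 2) + (d * f ^ 2 - 2 * f ^ 3) * lead (n + 1) - f ^ 4 * lead n)) = 0"
    by (simp add: J_def side_Suc[of "Suc n"] numeral_eq_Suc algebra_simps)
  then show ?thesis using J0[of n] J0[of "Suc n"] by simp
qed

lemma lead_0: "lead 0 = 1"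
  by (simp add: lead_def)

lemma lead_1: "lead 1 = B 0 0"
  unfolding lead_def by (simp add: det_last_row)

lemma side_0: "side 0 = B 1 0"
  unfolding side_def by (simp add: det_last_row insert_index_def)

lemma gap_0: "gap 0 = B 1 1"
  unfolding gap_def by (simp add: det_last_row insert_index_def)

lemma lead_2: "lead 2 = B 0 0 * B 1 1 - B 1 0 ^ 2"
  using sym[of 0 1] unfolding lead_def 
  by (simp add: det_last_row insert_index_def numeral_2_eq_2 algebra_simps)

end

section \<open>The Hankel determinants of the central transform\<close>

text \<open>
  The moment representation combined with the change of basis: the \<open>q\<^sub>n\<close> are monic in \<open>u\<close> for every
  \<open>a\<close>, and for \<open>g = g\<^sub>a\<^sub>b\<close> they make the matrix sparse.
\<close>

lemma hankel_det_central_transform: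
  assumes "fps_nth g 0 \<noteq> 0"
  shows "hankel_det (central_transform g) n =
    det (mat (Suc n) (Suc n) (\<lambda>(i, j). constant_term (inverse g) (szego a i * szego a j)))"
proof -
  have "hankel_det (central_transform g) n =
      det (mat (Suc n) (Suc n) (\<lambda>(i, j). constant_term (inverse g) (laurent_u ^ i * laurent_u ^ j)))"
    by (simp add: hankel_det_def central_transform_def constant_term_def
        central_coeff_constant_term[OF assms] power_add)
  also have "\<dots> = det (mat (Suc n) (Suc n) (\<lambda>(i, j). constant_term (inverse g) (szego a i * szego a j)))"
    by (intro gram_det_unitriangular lower_comb_power szego_step) (simp add: szego_def)
  finally show ?thesis .
qed

lemma pentadiagonal_szego_gram:
  "pentadiagonal (\<lambda>i j. constant_term (weight a b) (szego a i * szego a j)) 2 (a * (1 - b)) (- b)"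
proof (rule pentadiagonal.intro)
  fix i j :: nat
  let ?G = "\<lambda>i j. constant_term (weight a b) (szego a i * szego a j)"
  show "?G i j = ?G j i" by (simp only: mult.commute)
  show "?G i j = 0" if "j + 2 < i" by (rule szego_gram(7)[OF that])
  show "?G i i = 2" if "2 \<le> i" by (rule szego_gram(4)[OF that])
  show "?G (Suc i) i = a * (1 - b)" if "1 \<le> i" by (rule szego_gram(5)[OF that])
  show "?G (Suc (Suc i)) i = - b" by (rule szego_gram(6))
qed

lemma fps_const_X_power_mult_nth:
  "fps_nth (fps_const c * fps_X ^ k * F) n = (if n < k then 0 else c * fps_nth F (n - k))"
  for F :: "'a::comm_ring_1 fps"
  by (simp add: mult.assoc fps_X_power_mult_nth)

text \<open>
  The values at 0 to 3 are what the recurrence would give for zero values at negative indices, corrected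
  by the numerator coefficients.
\<close>

lemma fps_order_four_recurrence:
  fixes H :: "'a::field fps"
  assumes "fps_nth H 0 = n0"
    and "fps_nth H 1 = c1 * n0 - n1"
    and "fps_nth H 2 = c1 * fps_nth H 1 - c2 * n0 + n2"
    and "fps_nth H 3 = c1 * fps_nth H 2 - c2 * fps_nth H 1 + c3 * n0 - n3"
    and "\<And>n. n \<ge> 4 \<Longrightarrow> fps_nth H n = c1 * fps_nth H (n - 1) - c2 * fps_nth H (n - 2)
      + c3 * fps_nth H (n - 3) - c4 * fps_nth H (n - 4)"
  shows "H = (fps_const n0 - fps_const n1 * fps_X + fps_const n2 * fps_X ^ 2 - fps_const n3 * fps_X ^ 3)
    / (1 - fps_const c1 * fps_X + fps_const c2 * fps_X ^ 2 - fps_const c3 * fps_X ^ 3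
       + fps_const c4 * fps_X ^ 4)" (is "H = ?N / ?D")
proof -
  have "H * ?D = H - fps_const c1 * fps_X ^ 1 * H + fps_const c2 * fps_X ^ 2 * H
      - fps_const c3 * fps_X ^ 3 * H + fps_const c4 * fps_X ^ 4 * H"
    by (simp add: algebra_simps)
  also have "\<dots> = fps_const n0 - fps_const n1 * fps_X ^ 1 + fps_const n2 * fps_X ^ 2
      - fps_const n3 * fps_X ^ 3" (is "?L = ?R")
  proof (rule fps_ext)
    fix n :: nat
    have L: "fps_nth ?L n = fps_nth H n - (if n < 1 then 0 else c1 * fps_nth H (n - 1))
        + (if n < 2 then 0 else c2 * fps_nth H (n - 2))
        - (if n < 3 then 0 else c3 * fps_nth H (n - 3))
        + (if n < 4 then 0 else c4 * fps_nth H (n - 4))"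
      by (simp only: fps_add_nth fps_sub_nth fps_const_X_power_mult_nth)
    have R: "fps_nth ?R n = (if n = 0 then n0 else 0) - (if n = 1 then n1 else 0)
        + (if n = 2 then n2 else 0) - (if n = 3 then n3 else 0)"
      by (simp add: fps_X_power_iff)
    consider "n = 0" | "n = 1" | "n = 2" | "n = 3" | "n \<ge> 4" by linarith
    then show "fps_nth ?L n = fps_nth ?R n"
      unfolding L R by cases (use assms in \<open>simp_all add: algebra_simps\<close>)
  qed
  finally have "H * ?D = ?N" by simp
  have D0: "fps_nth ?D 0 \<noteq> 0" by (simp add: fps_X_power_iff)
  have "H = H * (?D * inverse ?D)"
    unfolding inverse_mult_eq_1'[OF D0] by (rule mult_1_right[symmetric])
  also have "\<dots> = ?N * inverse ?D"
    unfolding \<open>H * ?D = ?N\<close>[symmetric] by (rule mult.assoc[symmetric])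
  also have "\<dots> = ?N / ?D"
    by (rule fps_divide_unit[OF D0, symmetric])
  finally show ?thesis .
qed

theorem theorem1p6:
  fixes a b :: "'a::field_char_0"
  shows "hankel_series (g_ab a b) =
      (1 - fps_const (3 * b) * fps_X + fps_const (b ^ 2 * (2 + b)) * fps_X ^ 2
         - fps_const (b ^ 4) * fps_X ^ 3)
      / (1 - fps_const (2 * (1 + b)) * fps_X
         + fps_const (a ^ 2 + 4 * b - 2 * a ^ 2 * b + 2 * b ^ 2 + a ^ 2 * b ^ 2) * fps_X ^ 2
         - fps_const (2 * b ^ 2 * (1 + b)) * fps_X ^ 3
         + fps_const (b ^ 4) * fps_X ^ 4)
    \<and> (let \<sigma> = a * (1 - b); h = hankel_det (central_transform (g_ab a b)) in
        h 0 = 1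
      \<and> h 1 = 2 - b
      \<and> h 2 = 4 - 2 * b - 2 * b ^ 2 + b ^ 3 - \<sigma> ^ 2
      \<and> h 3 = 8 - 4 * b - 6 * b ^ 2 + 2 * b ^ 3 + b ^ 4 - (b + 4) * \<sigma> ^ 2
      \<and> (\<forall>n\<ge>4. h n = 2 * (1 + b) * h (n - 1) - (\<sigma> ^ 2 + 4 * b + 2 * b ^ 2) * h (n - 2)
                     + 2 * b ^ 2 * (1 + b) * h (n - 3) - b ^ 4 * h (n - 4)))"
proof -
  define h where "h = hankel_det (central_transform (g_ab a b))"
  interpret pentadiagonal "\<lambda>i j. constant_term (weight a b) (szego a i * szego a j)" 2 "a * (1 - b)" "- b"
    by (rule pentadiagonal_szego_gram)
  have g0: "fps_nth (g_ab a b) 0 \<noteq> 0"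
    by (simp add: g_ab_def fps_divide_unit fps_X_power_iff)
  have h_lead: "h n = lead (n + 1)" for n
    using hankel_det_central_transform[OF g0, of n a] unfolding h_def lead_def unfolding weight_def by simp
  \<comment> \<open>The corner of the Gram matrix provides the initial values.\<close>
  have side0: "side 0 = 0" using side_0 by (simp add: szego_gram[simplified])
  have gap0: "gap 0 = 2 - b" using gap_0 by (simp add: szego_gram[simplified])
  have lead1: "lead 1 = 1" using lead_1 by (simp add: szego_gram)
  have lead2: "lead 2 = 2 - b" using lead_2 by (simp add: szego_gram[simplified])
  have side1: "side 1 = a * (1 - b)" using side_Suc[of 0] lead1 side0 by simp
  have lead3: "lead 3 = 4 - 2 * b - 2 * b ^ 2 + b ^ 3 - (a * (1 - b)) ^ 2"
    using lead_expand[of 0] unfolding add_0 One_nat_def[symmetric] lead2 side1 side0 gap0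
    by (simp add: power2_eq_square power3_eq_cube algebra_simps)
  have rec: "lead (n + 4) = 2 * (1 + b) * lead (n + 3) - ((a * (1 - b)) ^ 2 + 4 * b + 2 * b ^ 2) * lead (n + 2)
    + 2 * b ^ 2 * (1 + b) * lead (n + 1) - b ^ 4 * lead n" for n
  proof -
    \<comment> \<open>The corner entries are exactly such that the factor \<open>1 - f S\<close> drops out.\<close>
    have "lead 3 + (- b - 2) * lead 2 + ((- b) ^ 2 - 2 * (- b)) * lead 1 + (- b) ^ 3 * lead 0
        + a * (1 - b) * side 1 = 0"
      unfolding lead_0 lead1 lead2 lead3 side1 by (simp add: power2_eq_square power3_eq_cube algebra_simps)
    from lead_recurrence[OF this, of n] show ?thesis
      by (simp add: power2_eq_square power3_eq_cube power4_eq_xxxx algebra_simps)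
  qed
  have h0: "h 0 = 1" and h1: "h 1 = 2 - b"
    and h2: "h 2 = 4 - 2 * b - 2 * b ^ 2 + b ^ 3 - (a * (1 - b)) ^ 2"
    using lead1 lead2 lead3 by (simp_all add: h_lead numeral_eq_Suc)
  have lead4: "lead 4 = 8 - 4 * b - 6 * b ^ 2 + 2 * b ^ 3 + b ^ 4 - (b + 4) * (a * (1 - b)) ^ 2"
    using rec[of 0] unfolding add_0 lead_0 lead1 lead2 lead3
    by (simp add: power2_eq_square power3_eq_cube power4_eq_xxxx algebra_simps)
  then have h3: "h 3 = 8 - 4 * b - 6 * b ^ 2 + 2 * b ^ 3 + b ^ 4 - (b + 4) * (a * (1 - b)) ^ 2"
    by (simp add: h_lead)
  have h_rec: "h n = 2 * (1 + b) * h (n - 1) - ((a * (1 - b)) ^ 2 + 4 * b + 2 * b ^ 2) * h (n - 2)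
     + 2 * b ^ 2 * (1 + b) * h (n - 3) - b ^ 4 * h (n - 4)" if "n \<ge> 4" for n
  proof -
    from that obtain m where "n = m + 4" by (metis add.commute le_Suc_ex)
    then show ?thesis
      using rec[of "m + 1"] by (simp add: h_lead numeral_eq_Suc)
  qed
  have c2: "a ^ 2 + 4 * b - 2 * a ^ 2 * b + 2 * b ^ 2 + a ^ 2 * b ^ 2
      = (a * (1 - b)) ^ 2 + 4 * b + 2 * b ^ 2"
    by (simp add: power2_eq_square algebra_simps)
  have "hankel_series (g_ab a b) = (fps_const 1 - fps_const (3 * b) * fps_X
      + fps_const (b ^ 2 * (2 + b)) * fps_X ^ 2 - fps_const (b ^ 4) * fps_X ^ 3)
      / (1 - fps_const (2 * (1 + b)) * fps_X
         + fps_const (a ^ 2 + 4 * b - 2 * a ^ 2 * b + 2 * b ^ 2 + a ^ 2 * b ^ 2) * fps_X ^ 2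
         - fps_const (2 * b ^ 2 * (1 + b)) * fps_X ^ 3 + fps_const (b ^ 4) * fps_X ^ 4)"
    unfolding c2 hankel_series_def h_def[symmetric]
    by (rule fps_order_four_recurrence)
      (simp_all only: fps_nth_Abs_fps h0 h1 h2 h3 h_rec,
        simp_all add: power2_eq_square power3_eq_cube power4_eq_xxxx algebra_simps)
  then show ?thesis
    using h0 h1 h2 h3 h_rec by (simp add: Let_def h_def[symmetric])
qed

end
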